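(* For all $n\ge7$ there are two distinct maximal $K_{2,3}$-matroids on $K_n$ (maximal with respect to the weak order).
   Context: A $K_{2,3}$-matroid on $K_n$ is a matroid on $E(K_n)$ in which the edge set of every subgraph isomorphic to $K_{2,3}$ is a circuit. Weak order: ${\mathcal M}_1\preceq{\mathcal M}_2$ if every independent set of ${\mathcal M}_1$ is independent in ${\mathcal M}_2$. *)

theory Defs
  imports Main
begin

locale matroid =
  fixes ground :: "'a set" and indeps :: "'a set set"
  assumes finite_ground: "finite ground"
    and indeps_subset: "indeps \<subseteq> Pow ground"
    and indeps_empty: "{} \<in> indeps"
    and indeps_down: "X \<in> indeps \<Longrightarrow> Y \<subseteq> X \<Longrightarrow> Y \<in> indeps"
    and indeps_augment: "X \<in> indeps \<Longrightarrow> Y \<in> indeps \<Longrightarrow> card X < card Y \<Longrightarrow>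
      \<exists>e \<in> Y - X. insert e X \<in> indeps"

definition circuit :: "'a set \<Rightarrow> 'a set set \<Rightarrow> 'a set \<Rightarrow> bool" where
  "circuit ground indeps C \<longleftrightarrow> C \<subseteq> ground \<and> C \<notin> indeps \<and> (\<forall>D. D \<subset> C \<longrightarrow> D \<in> indeps)"

definition weak_le :: "'a set set \<Rightarrow> 'a set set \<Rightarrow> bool"  (infix "\<preceq>" 50) where
  "I \<preceq> J \<longleftrightarrow> (\<forall>X. X \<in> I \<longrightarrow> X \<in> J)"

definition complete_edges :: "nat \<Rightarrow> nat set set" where
  "complete_edges n = {{u, v} | u v. u < n \<and> v < n \<and> u \<noteq> v}"

definition bipartite_edges :: "nat set \<Rightarrow> nat set \<Rightarrow> nat set set" where
  "bipartite_edges A B = {{a, b} | a b. a \<in> A \<and> b \<in> B}"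

definition K23_matroid :: "nat \<Rightarrow> nat set set set \<Rightarrow> bool" where
  "K23_matroid n I \<longleftrightarrow> matroid (complete_edges n) I \<and>
     (\<forall>A B. A \<subseteq> {..<n} \<and> B \<subseteq> {..<n} \<and> A \<inter> B = {} \<and> card A = 2 \<and> card B = 3 \<longrightarrow>
        circuit (complete_edges n) I (bipartite_edges A B))"

definition maximal_K23_matroid :: "nat \<Rightarrow> nat set set set \<Rightarrow> bool" where
  "maximal_K23_matroid n I \<longleftrightarrow> K23_matroid n I \<and>
     (\<forall>J. K23_matroid n J \<and> I \<preceq> J \<longrightarrow> J = I)"

end

theory Submission imports Defs begin

text \<open>
  On a finite ground set every \<open>K\<^sub>2\<^sub>,\<^sub>3\<close>-matroid lies below a maximal one, so it suffices to find two
  \<open>K\<^sub>2\<^sub>,\<^sub>3\<close>-matroids without a common upper bound. The first is the sparse paving matroid of rank 6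
  whose dependent 6-sets are exactly the copies of \<open>K\<^sub>2\<^sub>,\<^sub>3\<close>; in it \<open>K\<^sub>4\<close> is independent. The second
  is the bicircular matroid, whose rank is \<open>n \<ge> 7\<close>. In every \<open>K\<^sub>2\<^sub>,\<^sub>3\<close>-matroid a copy of \<open>K\<^sub>5\<close> has rank
  at most 6. Hence if \<open>K\<^sub>4\<close> is independent, it spans every \<open>K\<^sub>5\<close> containing it, and then all of
  \<open>K\<^sub>n\<close>, so that the rank of the matroid is only 6.
\<close>

section \<open>Spans of independent sets\<close>

context matroid
begin

text \<open>For independent \<open>B\<close> this is the matroid closure. For dependent
  \<open>B\<close> it is all of \<open>ground\<close>, so it is only applied to independent
  sets.\<close>

definition span :: "'a set \<Rightarrow> 'a set" where
  "span B = {e \<in> ground. e \<in> B \<or> insert e B \<notin> indeps}"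

lemma indeps_finite: "X \<in> indeps \<Longrightarrow> finite X"
  using indeps_subset finite_ground finite_subset by blast

text \<open>If \<open>Y\<close> were larger, augmentation would extend \<open>B\<close> by an
  element of \<open>Y - B\<close>, which membership in \<open>span B\<close> forbids.\<close>

lemma card_indep_le_card:
  assumes "B \<in> indeps" "Y \<in> indeps" "Y \<subseteq> span B"
  shows "card Y \<le> card B"
proof (rule ccontr)
  assume "\<not> card Y \<le> card B"
  then obtain e where "e \<in> Y - B" "insert e B \<in> indeps"
    using indeps_augment[OF assms(1,2)] by auto
  then show False using assms(3) unfolding span_def by auto
qed

lemma indep_extend:
  assumes "X \<in> indeps" "B \<in> indeps" "card X \<le> card B"
  shows "\<exists>Z \<in> indeps. X \<subseteq> Z \<and> Z \<subseteq> X \<union> B \<and> card Z = card B"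
  using assms(1,3)
proof (induction "card B - card X" arbitrary: X)
  case 0
  then show ?case by (intro bexI[of _ X]) auto
next
  case (Suc k)
  then obtain e where e: "e \<in> B - X" "insert e X \<in> indeps"
    using indeps_augment[OF Suc.prems(1) assms(2)] by fastforce
  moreover have "card (insert e X) = Suc (card X)"
    using e indeps_finite[OF Suc.prems(1)] by simp
  ultimately obtain Z where "Z \<in> indeps" "insert e X \<subseteq> Z" "Z \<subseteq> insert e X \<union> B" "card Z = card B"
    using Suc.hyps(1)[of "insert e X"] Suc.hyps(2) by fastforce
  then show ?case using e by (intro bexI[of _ Z]) auto
qed

text \<open>The independent set \<open>C - {e}\<close> extends within
  \<open>(C - {e}) \<union> B\<close> to some \<open>Z\<close> of size \<open>card B\<close>. If
  \<open>insert e B\<close> were independent and larger than \<open>B\<close>, it would augment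
  \<open>Z\<close> by some \<open>f\<close>. Then either \<open>f = e\<close> completes the circuit,
  or \<open>insert f Z\<close> is an independent subset of \<open>span B\<close> that is too
  large.\<close>

lemma span_closed:
  assumes B: "B \<in> indeps" and C: "circuit ground indeps C"
    and e: "e \<in> C" and sub: "C - {e} \<subseteq> span B"
  shows "e \<in> span B"
proof (rule ccontr)
  assume "e \<notin> span B"
  then have eB: "e \<notin> B" "insert e B \<in> indeps"
    using C e unfolding circuit_def span_def by auto
  have BS: "B \<subseteq> span B" using B indeps_subset unfolding span_def by auto
  have Ce: "C - {e} \<in> indeps" using C e unfolding circuit_def by blast
  obtain Z where Z: "Z \<in> indeps" "C - {e} \<subseteq> Z" "Z \<subseteq> (C - {e}) \<union> B" "card Z = card B"
    using indep_extend[OF Ce B card_indep_le_card[OF B Ce sub]] by blast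
  have "card Z < card (insert e B)" using Z(4) eB(1) indeps_finite[OF B] by simp
  then obtain f where f: "f \<in> insert e B - Z" "insert f Z \<in> indeps"
    using indeps_augment[OF Z(1) eB(2)] by blast
  show False
  proof (cases "f = e")
    case True
    then have "C \<subseteq> insert f Z" using Z(2) by auto
    then show False using indeps_down[OF f(2)] C unfolding circuit_def by blast
  next
    case False
    then have "insert f Z \<subseteq> span B" using f Z(3) sub BS by auto
    from card_indep_le_card[OF B f(2) this] show False
      using Z(4) f(1) indeps_finite[OF Z(1)] by simp
  qed
qed

lemma spanning_indep_exists:
  assumes "X \<subseteq> ground"
  shows "\<exists>B \<in> indeps. B \<subseteq> X \<and> X \<subseteq> span B"
proof -
  let ?F = "{B \<in> indeps. B \<subseteq> X}"
  have "?F \<subseteq> Pow ground" using assms by auto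
  then have "finite ?F" using finite_ground by (auto intro: finite_subset)
  moreover have "{} \<in> ?F" using indeps_empty by simp
  ultimately have "\<exists>B \<in> ?F. {} \<subseteq> B \<and> (\<forall>B' \<in> ?F. B \<subseteq> B' \<longrightarrow> B = B')"
    by (rule finite_has_maximal2)
  then obtain B where B: "B \<in> ?F" "\<And>B'. B' \<in> ?F \<Longrightarrow> B \<subseteq> B' \<Longrightarrow> B = B'"
    by auto
  have "X \<subseteq> span B"
  proof
    fix x assume x: "x \<in> X"
    show "x \<in> span B"
      using B(1) B(2)[of "insert x B"] x assms unfolding span_def by blast
  qed
  then show ?thesis using B(1) by blast
qed

end

section \<open>Rank bounds in \<open>K\<^sub>2\<^sub>,\<^sub>3\<close>-matroids\<close>

lemma edge_in_complete_edges: "u < n \<Longrightarrow> v < n \<Longrightarrow> u \<noteq> v \<Longrightarrow> {u, v} \<in> complete_edges n"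
  unfolding complete_edges_def by blast

lemma bipartite_edges_image: "bipartite_edges A B = (\<lambda>(a, b). {a, b}) ` (A \<times> B)"
  unfolding bipartite_edges_def by auto

lemma doubleton_mem_bipartite_edges:
  "{u, v} \<in> bipartite_edges A B \<longleftrightarrow> (u \<in> A \<and> v \<in> B) \<or> (u \<in> B \<and> v \<in> A)"
  unfolding bipartite_edges_image by (auto simp: doubleton_eq_iff image_iff)

text \<open>The six edges between \<open>{a, b}\<close> and \<open>{p, q, r}\<close> form a circuit,
  so the five listed ones force the sixth into the span.\<close>

lemma K23_span:
  assumes K: "K23_matroid n I" and B: "B \<in> I"
    and d: "distinct [a, b, p, q, r]" "{a, b, p, q, r} \<subseteq> {..<n}"
    and s: "{{a, p}, {a, q}, {a, r}, {b, p}, {b, q}} \<subseteq> matroid.span (complete_edges n) I B"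
  shows "{b, r} \<in> matroid.span (complete_edges n) I B"
proof -
  interpret matroid "complete_edges n" I using K unfolding K23_matroid_def by blast
  have "circuit (complete_edges n) I (bipartite_edges {a, b} {p, q, r})"
    using K d unfolding K23_matroid_def by simp
  moreover have "{b, r} \<in> bipartite_edges {a, b} {p, q, r}"
    by (simp add: doubleton_mem_bipartite_edges)
  moreover have "bipartite_edges {a, b} {p, q, r} - {{b, r}} \<subseteq>
      {{a, p}, {a, q}, {a, r}, {b, p}, {b, q}}"
    by (auto simp: bipartite_edges_image)
  ultimately show ?thesis
    using span_closed[OF B] s by (meson subset_trans)
qed

lemma K5_rank_le_6:
  assumes K: "K23_matroid n I"
    and d: "distinct [a, b, p, q, r]" "{a, b, p, q, r} \<subseteq> {..<n}"
    and Y: "Y \<in> I" "Y \<subseteq> {{a, b}, {a, p}, {a, q}, {a, r}, {b, p}, {b, q}, {b, r}, {p, q}, {p, r}, {q, r}}"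
  shows "card Y \<le> 6"
proof -
  interpret matroid "complete_edges n" I using K unfolding K23_matroid_def by blast
  \<comment> \<open>Six edges generate all ten: K_4 on \<open>a, b, p, q\<close> without the edge
    \<open>{a, b}\<close>, plus the edge \<open>{a, r}\<close>. \<open>X\<close> itself may be
    dependent, hence the passage to \<open>B\<close>.\<close>
  define X where "X = {{a, p}, {a, q}, {a, r}, {b, p}, {b, q}, {p, q}}"
  have "X \<subseteq> complete_edges n" using d by (simp add: X_def edge_in_complete_edges)
  then obtain B where B: "B \<in> I" "B \<subseteq> X" "X \<subseteq> span B"
    using spanning_indep_exists by blast
  note X = B(3)[unfolded X_def insert_subset]
  note S = K23_span[OF K B(1)]
  \<comment> \<open>The four remaining edges are added in an order in which each completes a copy of
    K_{2,3} whose other five edges are already spanned. The smaller sides are \<open>{a, b}\<close>,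
    \<open>{p, r}\<close>, \<open>{q, r}\<close> and \<open>{p, a}\<close>; the next two copies use
    \<open>{b, r}\<close>, and the last uses \<open>{r, p}\<close>.\<close>
  have br: "{b, r} \<in> span B"
    by (rule S[of a b p q r]) (use d X in auto)
  have rq: "{r, q} \<in> span B"
    by (rule S[of p r a b q]) (use d X br in \<open>auto simp: insert_commute\<close>)
  have rp: "{r, p} \<in> span B"
    by (rule S[of q r a b p]) (use d X br in \<open>auto simp: insert_commute\<close>)
  have ab: "{a, b} \<in> span B"
    by (rule S[of p a q r b]) (use d X rp in \<open>auto simp: insert_commute\<close>)
  have "Y \<subseteq> span B"
    using Y(2) X br rq rp ab by (elim subset_trans) (simp add: insert_commute)
  then have "card Y \<le> card B" using card_indep_le_card B(1) Y(1) by blast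
  also have "\<dots> \<le> card X" using B(2) by (intro card_mono) (auto simp: X_def)
  also have "\<dots> \<le> 6" using card_length[of "[{a, p}, {a, q}, {a, r}, {b, p}, {b, q}, {p, q}]"] by (simp add: X_def)
  finally show ?thesis .
qed

definition K4_edges :: "nat set set" where
  "K4_edges = {{0, 1}, {0, 2}, {0, 3}, {1, 2}, {1, 3}, {2, 3}}"

lemma card_K4_edges: "card K4_edges = 6"
  unfolding K4_edges_def by (simp add: card_insert_if doubleton_eq_iff)

lemma rank_le_6_if_K4_indep:
  assumes K: "K23_matroid n I" and n: "n \<ge> 4" and Q: "K4_edges \<in> I" and Y: "Y \<in> I"
  shows "card Y \<le> 6"
proof -
  interpret matroid "complete_edges n" I using K unfolding K23_matroid_def by blast
  have Qs: "K4_edges \<subseteq> span K4_edges"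
    using Q indeps_subset unfolding span_def by auto
  \<comment> \<open>Otherwise \<open>{v, i}\<close> and the six edges of K_4 would be seven
    independent edges inside a K_5.\<close>
  have near: "{v, i} \<in> span K4_edges" if v: "v < n" "v \<ge> 4" and i: "i \<in> {0, 1, 2, 3}" for v i
  proof (rule ccontr)
    assume "{v, i} \<notin> span K4_edges"
    moreover have "{v, i} \<in> complete_edges n"
      using v i by (intro edge_in_complete_edges) auto
    ultimately have vi: "{v, i} \<notin> K4_edges" "insert {v, i} K4_edges \<in> I"
      unfolding span_def by auto
    have "insert {v, i} K4_edges \<subseteq>
        {{v, 0}, {v, 1}, {v, 2}, {v, 3}, {0, 1}, {0, 2}, {0, 3}, {1, 2}, {1, 3}, {2, 3}}"
      using i by (elim insertE emptyE) (simp_all add: K4_edges_def)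
    then have "card (insert {v, i} K4_edges) \<le> 6"
      by (intro K5_rank_le_6[OF K _ _ vi(2), of v 0 1 2 3]) (use v in simp_all)
    moreover have "finite K4_edges" unfolding K4_edges_def by simp
    ultimately show False using vi(1) card_K4_edges by simp
  qed
  have "complete_edges n \<subseteq> span K4_edges"
  proof
    fix e assume "e \<in> complete_edges n"
    then obtain u v where e: "e = {u, v}" "u < n" "v < n" "u \<noteq> v"
      unfolding complete_edges_def by blast
    show "e \<in> span K4_edges"
    proof (cases "u \<ge> 4")
      case u: True
      show ?thesis
      proof (cases "v \<ge> 4")
        case v: True
        have "{u, v} \<in> span K4_edges"
        \<comment> \<open>In the copy with sides \<open>{0, u}\<close> and \<open>{1, 2, v}\<close>,
          every edge except \<open>{u, v}\<close> meets \<open>{0, 1, 2, 3}\<close> and is already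
          spanned.\<close>
        proof (rule K23_span[OF K Q, of 0 u 1 2 v])
          have "{{0, 1}, {0, 2}} \<subseteq> span K4_edges"
            by (rule subset_trans[OF _ Qs]) (simp add: K4_edges_def)
          then show "{{0, 1}, {0, 2}, {0, v}, {u, 1}, {u, 2}} \<subseteq> span K4_edges"
            using u v e near[of u 1] near[of u 2] near[of v 0] by (simp add: insert_commute)
        qed (use u v e n in simp_all)
        then show ?thesis using e by simp
      next
        case False
        then have "v \<in> {0, 1, 2, 3}" by auto
        then show ?thesis using near[of u v] u e by simp
      qed
    next
      case False
      then have u: "u \<in> {0, 1, 2, 3}" by auto
      show ?thesis
      proof (cases "v \<ge> 4")
        case True
        then show ?thesis using near[of v u] u e by (simp add: insert_commute)
      next
        case False
        then have "v \<in> {0, 1, 2, 3}" by auto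
        then have "e \<in> K4_edges"
          using u e(4) unfolding e(1)
          by (elim insertE emptyE) (simp_all add: K4_edges_def doubleton_eq_iff)
        then show ?thesis using Qs by blast
      qed
    qed
  qed
  then have "Y \<subseteq> span K4_edges" using Y indeps_subset by blast
  from card_indep_le_card[OF Q Y this] show ?thesis by (simp add: card_K4_edges)
qed

section \<open>The sparse paving matroid of rank 6\<close>

text \<open>No bound on the vertices is imposed here; in \<open>paving_indeps\<close> it comes from
  containment in \<open>complete_edges n\<close>.\<close>

definition is_K23 :: "nat set set \<Rightarrow> bool" where
  "is_K23 X \<longleftrightarrow> (\<exists>A B. A \<inter> B = {} \<and> card A = 2 \<and> card B = 3 \<and> X = bipartite_edges A B)"

lemma card_bipartite_edges:
  assumes "A \<inter> B = {}"
  shows "card (bipartite_edges A B) = card A * card B"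
proof -
  have "inj_on (\<lambda>(a, b). {a, b}) (A \<times> B)"
    using assms by (auto simp: inj_on_def doubleton_eq_iff)
  then show ?thesis
    by (simp add: bipartite_edges_image card_image card_cartesian_product)
qed

lemma card_is_K23: "is_K23 X \<Longrightarrow> card X = 6"
  unfolding is_K23_def by (auto simp: card_bipartite_edges)

text \<open>Some vertex \<open>a \<in> A\<close> avoids the missing edge; its three neighbours must form the larger side.\<close>

lemma bipartite_edges_K23_subset:
  assumes d: "A \<inter> B = {}" "card A = 2" "card B = 3"
    and d': "A' \<inter> B' = {}" "card A' = 2" "card B' = 3"
    and sub: "bipartite_edges A B - {e} \<subseteq> bipartite_edges A' B'"
  shows "bipartite_edges A B \<subseteq> bipartite_edges A' B'"
proof (cases "e \<in> bipartite_edges A B")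
  case False
  then show ?thesis using sub by simp
next
  case True
  then obtain c b0 where e: "e = {c, b0}" "c \<in> A" "b0 \<in> B" unfolding bipartite_edges_def by blast
  obtain a where a: "a \<noteq> c" "A = {a, c}"
    using d(2) e(2) by (metis card_2_iff insert_commute insertE singletonD)
  have fin: "finite B" "finite A'" "finite B'" using d(3) d'(2,3) by (auto intro: card_ge_0_finite)
  have ab: "{a, b} \<in> bipartite_edges A' B'" if "b \<in> B" for b
  proof -
    have "{a, b} \<in> bipartite_edges A B" using a that unfolding bipartite_edges_def by blast
    moreover have "{a, b} \<noteq> e" using e a that d(1) by (auto simp: doubleton_eq_iff)
    ultimately show ?thesis using sub by blast
  qed
  have side: "(a \<in> A' \<and> b \<in> B') \<or> (a \<in> B' \<and> b \<in> A')" if "b \<in> B" for b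
    using ab[OF that] by (simp add: doubleton_mem_bipartite_edges)
  have aA': "a \<in> A'"
  proof (rule ccontr)
    assume "a \<notin> A'"
    then have "B \<subseteq> A'" using side by blast
    then have "card B \<le> card A'" using fin by (intro card_mono)
    then show False using d(3) d'(2) by simp
  qed
  then have "B \<subseteq> B'" using side d'(1) by blast
  then have BB: "B = B'" using fin d(3) d'(3) by (intro card_subset_eq) auto
  \<comment> \<open>The other vertex \<open>c\<close> still has a neighbour \<open>b1\<close> after
    \<open>e\<close> is removed. As \<open>b1\<close> lies in \<open>B = B'\<close>, the kept edge
    \<open>{c, b1}\<close> places \<open>c\<close> in \<open>A'\<close>.\<close>
  have "card (B - {b0}) = 2" using e(3) d(3) fin by simp
  then obtain b1 where b1: "b1 \<in> B" "b1 \<noteq> b0" by (metis Diff_iff card_2_iff insertI1)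
  have "{c, b1} \<in> bipartite_edges A B" using e b1 unfolding bipartite_edges_def by blast
  moreover have "{c, b1} \<noteq> e" using e b1 d(1) by (auto simp: doubleton_eq_iff)
  ultimately have "{c, b1} \<in> bipartite_edges A' B'" using sub by blast
  then have "c \<in> A'" using b1 BB d'(1) by (auto simp: doubleton_mem_bipartite_edges)
  then have "A \<subseteq> A'" using a aA' by simp
  then show ?thesis using BB unfolding bipartite_edges_def by blast
qed

text \<open>The first copy without \<open>e\<close> lies in the second, hence so does the whole
  first copy, and both have six edges. Thus distinct copies never share five edges, which is the
  condition behind a sparse paving matroid.\<close>

lemma is_K23_insert_unique:
  assumes "is_K23 (insert e X)" "is_K23 (insert f X)"
  shows "insert e X = insert f X"
proof -
  obtain A B where AB: "A \<inter> B = {}" "card A = 2" "card B = 3" "insert e X = bipartite_edges A B"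
    using assms(1) unfolding is_K23_def by blast
  obtain A' B' where AB': "A' \<inter> B' = {}" "card A' = 2" "card B' = 3" "insert f X = bipartite_edges A' B'"
    using assms(2) unfolding is_K23_def by blast
  have "insert e X \<subseteq> insert f X"
    unfolding AB(4) AB'(4)
    by (rule bipartite_edges_K23_subset[OF AB(1-3) AB'(1-3), of e]) (use AB(4) AB'(4) in blast)
  moreover have "finite (insert f X)"
    using card_is_K23[OF assms(2)] by (intro card_ge_0_finite) simp
  ultimately show ?thesis
    using card_is_K23[OF assms(1)] card_is_K23[OF assms(2)] by (intro card_subset_eq) auto
qed

definition paving_indeps :: "nat \<Rightarrow> nat set set set" where
  "paving_indeps n = {X. X \<subseteq> complete_edges n \<and> card X \<le> 6 \<and> \<not> is_K23 X}"

lemma finite_complete_edges: "finite (complete_edges n)"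
proof -
  have "complete_edges n \<subseteq> Pow {..<n}" unfolding complete_edges_def by auto
  then show ?thesis by (rule finite_subset) simp
qed

lemma bipartite_edges_subset:
  "A \<subseteq> {..<n} \<Longrightarrow> B \<subseteq> {..<n} \<Longrightarrow> A \<inter> B = {} \<Longrightarrow> bipartite_edges A B \<subseteq> complete_edges n"
  unfolding bipartite_edges_def complete_edges_def by blast

lemma matroid_paving: "matroid (complete_edges n) (paving_indeps n)"
proof
  show "finite (complete_edges n)" by (rule finite_complete_edges)
  show "paving_indeps n \<subseteq> Pow (complete_edges n)" unfolding paving_indeps_def by blast
  show "{} \<in> paving_indeps n" unfolding paving_indeps_def using card_is_K23 by fastforce
next
  fix X Y assume X: "X \<in> paving_indeps n" and YX: "Y \<subseteq> X"
  have fX: "finite X" using X finite_complete_edges finite_subset unfolding paving_indeps_def by blast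
  have "\<not> is_K23 Y"
  proof
    assume Y: "is_K23 Y"
    then have "Y = X"
      using card_is_K23[OF Y] X YX card_mono[OF fX YX] fX unfolding paving_indeps_def
      by (intro card_subset_eq) auto
    then show False using Y X unfolding paving_indeps_def by blast
  qed
  then show "Y \<in> paving_indeps n"
    using X YX card_mono[OF fX YX] unfolding paving_indeps_def by auto
next
  fix X Y assume X: "X \<in> paving_indeps n" and Y: "Y \<in> paving_indeps n" and c: "card X < card Y"
  have fX: "finite X" and fY: "finite Y"
    using X Y finite_complete_edges finite_subset unfolding paving_indeps_def by blast+
  obtain e where e: "e \<in> Y - X"
    using c card_mono[OF fX, of Y] by fastforce
  show "\<exists>e \<in> Y - X. insert e X \<in> paving_indeps n"
  proof (rule ccontr)
    assume neg: "\<not> ?thesis"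
    \<comment> \<open>Since \<open>card X < card Y \<le> 6\<close>, the size bound cannot block
      \<open>insert f X\<close>; only being a copy of K_{2,3} can. Uniqueness then leaves a single
      candidate \<open>e\<close>, so \<open>Y\<close> equals the dependent set
      \<open>insert e X\<close>.\<close>
    have K: "is_K23 (insert f X)" if "f \<in> Y - X" for f
      using neg that X Y c fX unfolding paving_indeps_def by auto
    have "f = e" if "f \<in> Y - X" for f
      using is_K23_insert_unique[OF K[OF that] K[OF e]] that by blast
    then have "Y \<subseteq> insert e X" by blast
    then have "Y = insert e X"
      using c e fX by (intro card_seteq) auto
    then show False using K[OF e] Y unfolding paving_indeps_def by simp
  qed
qed

lemma K23_matroid_paving: "K23_matroid n (paving_indeps n)"
  unfolding K23_matroid_def
proof (intro conjI allI impI)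
  show "matroid (complete_edges n) (paving_indeps n)" by (rule matroid_paving)
  fix A B :: "nat set"
  assume AB: "A \<subseteq> {..<n} \<and> B \<subseteq> {..<n} \<and> A \<inter> B = {} \<and> card A = 2 \<and> card B = 3"
  then have K: "is_K23 (bipartite_edges A B)" unfolding is_K23_def by blast
  have sub: "bipartite_edges A B \<subseteq> complete_edges n" using AB bipartite_edges_subset by blast
  have "D \<in> paving_indeps n" if "D \<subset> bipartite_edges A B" for D
  proof -
    have "card D < 6"
      using psubset_card_mono[OF finite_subset[OF sub finite_complete_edges] that] card_is_K23[OF K] by simp
    then show ?thesis using that sub card_is_K23[of D] unfolding paving_indeps_def by auto
  qed
  then show "circuit (complete_edges n) (paving_indeps n) (bipartite_edges A B)"
    using K sub unfolding circuit_def paving_indeps_def by blast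
qed

lemma K4_edges_paving:
  assumes "n \<ge> 4"
  shows "K4_edges \<in> paving_indeps n"
proof -
  have "\<not> is_K23 K4_edges"
  proof
    assume "is_K23 K4_edges"
    then obtain A B where AB: "A \<inter> B = {}" "K4_edges = bipartite_edges A B"
      unfolding is_K23_def by blast
    have *: "(u \<in> A \<and> v \<in> B) \<or> (u \<in> B \<and> v \<in> A)" if "{u, v} \<in> K4_edges" for u v
      using that unfolding AB(2) by (simp add: doubleton_mem_bipartite_edges)
    \<comment> \<open>The triangle on 0, 1, 2 cannot be split between two disjoint sides.\<close>
    show False
      using *[of 0 1] *[of 0 2] *[of 1 2] AB(1) unfolding K4_edges_def by auto
  qed
  moreover have "K4_edges \<subseteq> complete_edges n"
    using assms by (simp add: K4_edges_def edge_in_complete_edges)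
  ultimately show ?thesis unfolding paving_indeps_def by (simp add: card_K4_edges)
qed

section \<open>The bicircular matroid\<close>

text \<open>\<open>\<Union>X\<close> is the set of vertices covered by \<open>X\<close>. The
  counting condition says that every connected component has at most one cycle; in this form it
  suits submodularity arguments.\<close>

definition bicircular_indeps :: "nat \<Rightarrow> nat set set set" where
  "bicircular_indeps n = {F. F \<subseteq> complete_edges n \<and> (\<forall>X \<subseteq> F. card X \<le> card (\<Union>X))}"

lemma finite_Union_edges: "X \<subseteq> complete_edges n \<Longrightarrow> finite (\<Union>X)"
proof (rule finite_subset)
  show "X \<subseteq> complete_edges n \<Longrightarrow> \<Union>X \<subseteq> {..<n}" unfolding complete_edges_def by blast
qed simp

text \<open>Edge counts are modular and vertex counts submodular. Both the union and the
  intersection satisfy the independence bound, so equality for \<open>X\<close> and \<open>Y\<close>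
  leaves no slack for the union.\<close>

lemma tight_union:
  assumes F: "F \<in> bicircular_indeps n" and XY: "X \<subseteq> F" "Y \<subseteq> F"
    and t: "card X = card (\<Union>X)" "card Y = card (\<Union>Y)"
  shows "card (X \<union> Y) = card (\<Union>(X \<union> Y))"
proof -
  have FE: "F \<subseteq> complete_edges n" using F unfolding bicircular_indeps_def by blast
  then have fin: "finite X" "finite Y" "finite (\<Union>X)" "finite (\<Union>Y)"
    using XY finite_subset[OF _ finite_complete_edges] finite_Union_edges by (meson subset_trans)+
  have "card (X \<inter> Y) \<le> card (\<Union>(X \<inter> Y))" "card (X \<union> Y) \<le> card (\<Union>(X \<union> Y))"
    using F XY unfolding bicircular_indeps_def mem_Collect_eq by (meson Un_least le_infI1)+
  moreover have "card (\<Union>(X \<inter> Y)) \<le> card (\<Union>X \<inter> \<Union>Y)"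
    using fin by (intro card_mono) auto
  moreover have "card X + card Y = card (X \<union> Y) + card (X \<inter> Y)"
    using fin by (intro card_Un_Int)
  moreover have "card (\<Union>X) + card (\<Union>Y) = card (\<Union>(X \<union> Y)) + card (\<Union>X \<inter> \<Union>Y)"
    using card_Un_Int[OF fin(3,4)] by simp
  ultimately show ?thesis using t by linarith
qed

lemma matroid_bicircular: "matroid (complete_edges n) (bicircular_indeps n)"
proof
  show "finite (complete_edges n)" by (rule finite_complete_edges)
  show "bicircular_indeps n \<subseteq> Pow (complete_edges n)" unfolding bicircular_indeps_def by blast
  show "{} \<in> bicircular_indeps n" unfolding bicircular_indeps_def by simp
  show "Y \<in> bicircular_indeps n" if "X \<in> bicircular_indeps n" "Y \<subseteq> X" for X Y
    using that unfolding bicircular_indeps_def by blast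
next
  fix X Y assume X: "X \<in> bicircular_indeps n" and Y: "Y \<in> bicircular_indeps n"
    and c: "card X < card Y"
  have XE: "X \<subseteq> complete_edges n" and YE: "Y \<subseteq> complete_edges n"
    using X Y unfolding bicircular_indeps_def by auto
  have fX: "finite X" and fY: "finite Y"
    using XE YE finite_complete_edges finite_subset by blast+
  let ?tight = "{T. T \<subseteq> X \<and> card T = card (\<Union>T)}"
  have "finite ?tight" using fX by simp
  moreover have "{} \<in> ?tight" by simp
  ultimately have "\<exists>T \<in> ?tight. {} \<subseteq> T \<and> (\<forall>T' \<in> ?tight. T \<subseteq> T' \<longrightarrow> T = T')"
    by (rule finite_has_maximal2)
  then obtain T where T: "T \<in> ?tight" "\<And>T'. T' \<in> ?tight \<Longrightarrow> T \<subseteq> T' \<Longrightarrow> T = T'"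
    by auto
  \<comment> \<open>Tight sets are closed under union, so the maximal one contains all
    others.\<close>
  have Tmax: "T' \<subseteq> T" if "T' \<in> ?tight" for T'
    using T(2)[of "T \<union> T'"] tight_union[OF X, of T T'] T(1) that by blast
  show "\<exists>e \<in> Y - X. insert e X \<in> bicircular_indeps n"
  proof (rule ccontr)
    assume neg: "\<not> ?thesis"
    \<comment> \<open>A set \<open>Z\<close> violating the bound must contain \<open>e\<close>. The
      rest \<open>W\<close> of it is then tight and already covers both ends of \<open>e\<close>,
      and \<open>W\<close> lies in \<open>T\<close>.\<close>
    have in_T: "e \<subseteq> \<Union>T" if e: "e \<in> Y - X" for e
    proof -
      have eE: "insert e X \<subseteq> complete_edges n" using e XE YE by blast
      then obtain Z where Z: "Z \<subseteq> insert e X" "card (\<Union>Z) < card Z"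
        using neg e unfolding bicircular_indeps_def by (auto simp: not_le)
      define W where "W = Z - {e}"
      have W: "W \<subseteq> X" using Z(1) unfolding W_def by blast
      then have Wc: "card W \<le> card (\<Union>W)" using X unfolding bicircular_indeps_def by blast
      have finZ: "finite Z" "finite (\<Union>Z)"
        using Z(1) fX finite_subset[of Z "insert e X"] finite_Union_edges[of Z n] eE by auto
      have "e \<in> Z"
      proof (rule ccontr)
        assume "e \<notin> Z"
        then show False using Wc Z(2) unfolding W_def by simp
      qed
      then have ZW: "Z = insert e W" "card Z = Suc (card W)"
        using finZ(1) card_Suc_Diff1[of Z e] unfolding W_def by auto
      have le: "card (\<Union>W) \<le> card (\<Union>Z)" using finZ ZW(1) by (intro card_mono) auto
      have "\<Union>W = \<Union>Z" using finZ ZW Wc Z(2) by (intro card_seteq) auto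
      moreover have "card W = card (\<Union>W)" using le ZW(2) Wc Z(2) by linarith
      ultimately show ?thesis using Tmax[of W] W ZW(1) by blast
    qed
    \<comment> \<open>Inside \<open>\<Union>T\<close>, independence of \<open>Y\<close> and
      tightness of \<open>T\<close> allow at most \<open>card T\<close> edges of \<open>Y\<close>.
      All other edges of \<open>Y\<close> belong to \<open>X - T\<close>. Together this contradicts
      \<open>card X < card Y\<close>.\<close>
    let ?Y1 = "{e \<in> Y. e \<subseteq> \<Union>T}"
    have fT: "finite (\<Union>T)" using T(1) XE finite_Union_edges[of T n] by auto
    have "?Y1 \<subseteq> Y" by blast
    then have "card ?Y1 \<le> card (\<Union>?Y1)" using Y unfolding bicircular_indeps_def by simp
    also have "\<dots> \<le> card (\<Union>T)" using fT by (intro card_mono) auto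
    also have "\<dots> = card T" using T(1) by simp
    finally have 1: "card ?Y1 \<le> card T" .
    have "Y - ?Y1 \<subseteq> X - T" using in_T by auto
    then have 2: "card (Y - ?Y1) \<le> card (X - T)" using fX by (intro card_mono) auto
    have "card Y = card ?Y1 + card (Y - ?Y1)"
      using fY card_Diff_subset[of ?Y1 Y] card_mono[of Y ?Y1] by simp
    moreover have "card X = card T + card (X - T)"
      using fX T(1) card_Diff_subset[of T X] card_mono[of X T] finite_subset[of T X] by simp
    ultimately show False using 1 2 c by linarith
  qed
qed

text \<open>If \<open>X\<close> covers i vertices of \<open>A\<close> and j of \<open>B\<close>, it
  has at most ij edges and covers i + j vertices. For i at most 2 and j at most 3, ij exceeds i + j
  only at (2, 3), where a proper subset still has at most 5 edges.\<close>

lemma card_proper_subset_K23: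
  assumes d: "A \<inter> B = {}" "card A = 2" "card B = 3" and X: "X \<subset> bipartite_edges A B"
  shows "card X \<le> card (\<Union>X)"
proof -
  have fin: "finite A" "finite B" using d by (auto intro: card_ge_0_finite)
  have cK: "card (bipartite_edges A B) = 6" using d by (simp add: card_bipartite_edges)
  then have X5: "card X < 6"
    using psubset_card_mono[OF card_ge_0_finite X] by simp
  let ?A = "A \<inter> \<Union>X" and ?B = "B \<inter> \<Union>X"
  have "X \<subseteq> bipartite_edges ?A ?B"
  proof
    fix x assume x: "x \<in> X"
    then obtain a b where "x = {a, b}" "a \<in> A" "b \<in> B"
      using X unfolding bipartite_edges_def by blast
    then show "x \<in> bipartite_edges ?A ?B" using x unfolding bipartite_edges_def by blast
  qed
  moreover have "finite (bipartite_edges ?A ?B)" using fin by (simp add: bipartite_edges_image)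
  ultimately have "card X \<le> card (bipartite_edges ?A ?B)" by (rule card_mono[rotated])
  also have "\<dots> = card ?A * card ?B" using d(1) by (intro card_bipartite_edges) auto
  finally have le: "card X \<le> card ?A * card ?B" .
  have "\<Union>X \<subseteq> A \<union> B" using X unfolding bipartite_edges_def by auto
  then have "\<Union>X = ?A \<union> ?B" by auto
  moreover have "card (?A \<union> ?B) = card ?A + card ?B"
    using fin d(1) by (intro card_Un_disjoint) auto
  ultimately have "card (\<Union>X) = card ?A + card ?B" by simp
  moreover have "card ?A \<le> 2" "card ?B \<le> 3"
    using card_mono[OF fin(1), of ?A] card_mono[OF fin(2), of ?B] d by auto
  then have "card ?A \<in> {0, 1, 2}" "card ?B \<in> {0, 1, 2, 3}" by auto
  ultimately show ?thesis using le X5 by auto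
qed

lemma K23_matroid_bicircular: "K23_matroid n (bicircular_indeps n)"
  unfolding K23_matroid_def
proof (intro conjI allI impI)
  show "matroid (complete_edges n) (bicircular_indeps n)" by (rule matroid_bicircular)
  fix A B :: "nat set"
  assume AB: "A \<subseteq> {..<n} \<and> B \<subseteq> {..<n} \<and> A \<inter> B = {} \<and> card A = 2 \<and> card B = 3"
  let ?K = "bipartite_edges A B"
  have sub: "?K \<subseteq> complete_edges n" using AB bipartite_edges_subset by blast
  have fin: "finite A" "finite B" using AB by (auto intro: card_ge_0_finite)
  \<comment> \<open>Dependence of the full copy: six edges on at most five vertices.\<close>
  have "card (\<Union>?K) \<le> card (A \<union> B)"
    using fin by (intro card_mono) (auto simp: bipartite_edges_def)
  also have "\<dots> \<le> 5" using card_Un_le[of A B] AB by simp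
  also have "5 < card ?K" using AB by (simp add: card_bipartite_edges)
  finally have "?K \<notin> bicircular_indeps n"
    unfolding bicircular_indeps_def by (auto simp: not_le)
  moreover have "D \<in> bicircular_indeps n" if "D \<subset> ?K" for D
  proof -
    have "card X \<le> card (\<Union>X)" if "X \<subseteq> D" for X
      using card_proper_subset_K23[of A B X] AB subset_psubset_trans[OF that \<open>D \<subset> ?K\<close>] by simp
    then show ?thesis using that sub unfolding bicircular_indeps_def by blast
  qed
  ultimately show "circuit (complete_edges n) (bicircular_indeps n) ?K"
    using sub unfolding circuit_def by blast
qed

lemma bicircular_indep_card_7:
  assumes "n \<ge> 7"
  shows "\<exists>F \<in> bicircular_indeps n. card F = 7"
proof -
  \<comment> \<open>The witness is the 7-cycle on 0 to 6. Since \<open>g i\<close> contains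
    \<open>i\<close>, any set of its edges covers at least as many vertices as it has edges.\<close>
  define g :: "nat \<Rightarrow> nat set" where "g i = {i, if i = 6 then 0 else Suc i}" for i
  have inj: "inj_on g {..<7}"
    unfolding inj_on_def g_def by (auto simp: doubleton_eq_iff split: if_splits)
  have "card X \<le> card (\<Union>X)" if "X \<subseteq> g ` {..<7}" for X
  proof -
    from that obtain S where S: "S \<subseteq> {..<7}" "X = g ` S" by (rule subset_imageE)
    have fS: "finite S" using S(1) finite_subset by blast
    have "card X \<le> card S" using S(2) fS by (simp add: card_image_le)
    also have "\<dots> \<le> card (\<Union>X)"
      using fS unfolding S(2) by (intro card_mono) (auto simp: g_def)
    finally show ?thesis .
  qed
  moreover have "g ` {..<7} \<subseteq> complete_edges n"
    using assms unfolding g_def by (auto intro!: edge_in_complete_edges split: if_splits)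
  ultimately have "g ` {..<7} \<in> bicircular_indeps n" unfolding bicircular_indeps_def by blast
  moreover have "card (g ` {..<7}) = 7" using card_image[OF inj] by simp
  ultimately show ?thesis by blast
qed

section \<open>Maximal \<open>K\<^sub>2\<^sub>,\<^sub>3\<close>-matroids\<close>

text \<open>Lets maximality in the weak order be obtained from maximality under inclusion in a
  finite family.\<close>

lemma weak_le_iff_subset: "I \<preceq> J \<longleftrightarrow> I \<subseteq> J"
  unfolding weak_le_def by blast

lemma maximal_K23_matroid_above:
  assumes "K23_matroid n I"
  shows "\<exists>J. maximal_K23_matroid n J \<and> I \<subseteq> J"
proof -
  have "{J. K23_matroid n J} \<subseteq> Pow (Pow (complete_edges n))"
    unfolding K23_matroid_def matroid_def by blast
  then have "finite {J. K23_matroid n J}"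
    by (rule finite_subset) (simp add: finite_complete_edges)
  moreover have "I \<in> {J. K23_matroid n J}" using assms by simp
  ultimately have "\<exists>J \<in> {J. K23_matroid n J}. I \<subseteq> J \<and>
      (\<forall>J' \<in> {J. K23_matroid n J}. J \<subseteq> J' \<longrightarrow> J = J')"
    by (rule finite_has_maximal2)
  then obtain J where J: "K23_matroid n J" "I \<subseteq> J"
    "\<And>J'. K23_matroid n J' \<Longrightarrow> J \<subseteq> J' \<Longrightarrow> J = J'"
    by auto
  then have "maximal_K23_matroid n J"
    unfolding maximal_K23_matroid_def weak_le_iff_subset by blast
  then show ?thesis using J(2) by blast
qed

theorem theorem5p3:
  fixes n :: nat
  assumes "n \<ge> 7"
  shows "\<exists>I J. maximal_K23_matroid n I \<and> maximal_K23_matroid n J \<and> I \<noteq> J"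
proof -
  obtain I where I: "maximal_K23_matroid n I" "paving_indeps n \<subseteq> I"
    using maximal_K23_matroid_above[OF K23_matroid_paving] by blast
  obtain J where J: "maximal_K23_matroid n J" "bicircular_indeps n \<subseteq> J"
    using maximal_K23_matroid_above[OF K23_matroid_bicircular] by blast
  obtain F where F: "F \<in> J" "card F = 7"
    using bicircular_indep_card_7[OF assms] J(2) by blast
  \<comment> \<open>The seven-element set \<open>F\<close> separates \<open>I\<close> from
    \<open>J\<close>: an independent K_4 caps the rank of \<open>I\<close> at 6.\<close>
  have "K4_edges \<in> I" using K4_edges_paving[of n] assms I(2) by auto
  then have "F \<notin> I"
    using rank_le_6_if_K4_indep[of n I F] I(1) F(2) assms unfolding maximal_K23_matroid_def by auto
  then show ?thesis using I(1) J(1) F(1) by blast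
qed

end
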